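(* Let $d\ge1$ be a fixed integer and let $\mathcal{H}_d(n)$ be the set of normalized histograms $H$ with $N(H)\le n$. Then for $n\ge1$, $$|\mathcal{H}_d(n)|=\sum_{m=0}^{n}[x^m]\prod_{a\ge1}(1-x^a)^{-d}\le\exp\left(\pi\sqrt{\frac{2dn}{3}}\right).$$
   Context: A normalized histogram is a finitely supported array $H=(H_{a,r})_{a\ge1,\,1\le r\le d}$ of nonnegative integers, and $N(H)=\sum_{a\ge1}\sum_{r=1}^{d}a\,H_{a,r}$. $[x^m]$ denotes extraction of the coefficient of $x^m$ in a formal power series. *)

theory Defs
  imports "HOL-Analysis.Analysis" "HOL-Computational_Algebra.Formal_Power_Series"
begin

text \<open>
  The array \<open>(H a r)\<close> with \<open>a \<ge> 1\<close> and \<open>1 \<le> r \<le> d\<close> is a total function that is zero outside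
  this index range, so that distinct functions are distinct arrays.
\<close>

definition normalized_histogram :: "nat \<Rightarrow> (nat \<Rightarrow> nat \<Rightarrow> nat) \<Rightarrow> bool" where
  "normalized_histogram d H \<longleftrightarrow>
     (\<forall>a r. H a r \<noteq> 0 \<longrightarrow> 1 \<le> a \<and> 1 \<le> r \<and> r \<le> d) \<and>
     finite {(a, r). H a r \<noteq> 0}"

text \<open>
  The sum over all \<open>a \<ge> 1\<close> is restricted to the finitely many rows that are not identically zero,
  because \<^const>\<open>sum\<close> is only meaningful on finite index sets.
\<close>

definition histogram_size :: "nat \<Rightarrow> (nat \<Rightarrow> nat \<Rightarrow> nat) \<Rightarrow> nat" where
  "histogram_size d H =
     (\<Sum>a | 1 \<le> a \<and> (\<exists>r\<in>{1..d}. H a r \<noteq> 0). \<Sum>r=1..d. a * H a r)"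

definition histograms :: "nat \<Rightarrow> nat \<Rightarrow> (nat \<Rightarrow> nat \<Rightarrow> nat) set" where
  "histograms d n = {H. normalized_histogram d H \<and> histogram_size d H \<le> n}"

text \<open>
  The product is the library's infinite product, taken in the topology of formal power series;
  it is indexed from 0, hence the shift of the exponent \<open>a\<close>.
\<close>

definition histogram_gf :: "nat \<Rightarrow> real fps" where
  "histogram_gf d = (\<Prod>a. (1 - fps_X ^ Suc a) powi (- int d))"

end

theory Submission
  imports Defs
begin

text \<open>
  Weighting a histogram \<open>H\<close> by \<open>x\<^bsup>N(H)\<^esup>\<close> turns the sum over all histograms into an
  Euler product. In formal power series this gives the counting formula. For \<open>x = exp (-t)\<close> it
  yields \<open>|H\<^sub>d(n)| \<le> exp (t n) \<Prod>\<^sub>a (1 - x\<^sup>a)\<^bsup>-d\<^esup>\<close>. Expanding the logarithms and using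
  \<open>exp (k t) - 1 \<ge> k t\<close> together with \<open>\<zeta>(2) = \<pi>\<^sup>2 / 6\<close> bounds the product by
  \<open>exp (d \<pi>\<^sup>2 / (6 t))\<close>, and \<open>t = \<pi> sqrt (d / (6 n))\<close> is the optimal choice.
\<close>

subsection \<open>Histograms as functions on a finite grid\<close>

definition grid_weight :: "nat \<Rightarrow> nat \<Rightarrow> (nat \<times> nat \<Rightarrow> nat) \<Rightarrow> nat" where
  "grid_weight d n g = (\<Sum>p\<in>{1..n} \<times> {1..d}. fst p * g p)"

text \<open>The cap \<open>n\<close> on the values makes this a finite set, so that sums over it
  need no convergence argument; every histogram of size at most \<open>n\<close> fits under it.
  Extensionality makes distinct functions differ on the grid.\<close>

definition grid_functions :: "nat \<Rightarrow> nat \<Rightarrow> (nat \<times> nat \<Rightarrow> nat) set" where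
  "grid_functions d n = ({1..n} \<times> {1..d}) \<rightarrow>\<^sub>E {..n}"

lemma finite_grid_functions: "finite (grid_functions d n)"
  unfolding grid_functions_def by (intro finite_PiE) auto

lemma histogram_entry_le_size:
  assumes "normalized_histogram d H"
  shows "a * H a r \<le> histogram_size d H"
proof (cases "H a r = 0")
  case False
  have ar: "1 \<le> a" "r \<in> {1..d}"
    using assms False by (auto simp: normalized_histogram_def)
  let ?A = "{a. 1 \<le> a \<and> (\<exists>r\<in>{1..d}. H a r \<noteq> 0)}"
  have "finite ?A"
    by (rule finite_subset[of _ "fst ` {(a, r). H a r \<noteq> 0}"])
       (use assms in \<open>force simp: normalized_histogram_def\<close>)+
  have "a * H a r \<le> (\<Sum>r=1..d. a * H a r)"
    using ar by (intro member_le_sum) auto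
  also have "\<dots> \<le> (\<Sum>a\<in>?A. \<Sum>r=1..d. a * H a r)"
    using ar False \<open>finite ?A\<close>
    by (intro member_le_sum[of a ?A "\<lambda>a. \<Sum>r=1..d. a * H a r"]) auto
  finally show ?thesis
    by (simp add: histogram_size_def)
qed auto

lemma histogram_size_eq_grid_weight:
  assumes "\<And>a r. H a r \<noteq> 0 \<Longrightarrow> (a, r) \<in> {1..n} \<times> {1..d}"
  shows "histogram_size d H = grid_weight d n (\<lambda>(a, r). H a r)"
proof -
  have "histogram_size d H = (\<Sum>a\<in>{1..n}. \<Sum>r=1..d. a * H a r)"
    unfolding histogram_size_def
    by (rule sum.mono_neutral_left) (use assms in auto)
  also have "\<dots> = grid_weight d n (\<lambda>(a, r). H a r)"
    unfolding grid_weight_def by (simp add: sum.cartesian_product split_beta)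
  finally show ?thesis .
qed

text \<open>A nonzero entry satisfies \<open>a * H a r \<le> n\<close> with both factors at least 1,
  so each factor is at most \<open>n\<close>.\<close>

lemma histograms_support:
  assumes "H \<in> histograms d n" "H a r \<noteq> 0"
  shows "(a, r) \<in> {1..n} \<times> {1..d}" "H a r \<le> n"
proof -
  have H: "normalized_histogram d H" and "histogram_size d H \<le> n"
    using assms(1) by (auto simp: histograms_def)
  then have le: "a * H a r \<le> n"
    using histogram_entry_le_size[OF H, of a r] by linarith
  have ar: "1 \<le> a" "1 \<le> r" "r \<le> d"
    using H assms(2) by (auto simp: normalized_histogram_def)
  have "a * 1 \<le> a * H a r" "1 * H a r \<le> a * H a r"
    using ar assms(2) by (intro mult_le_mono; simp)+
  then have "a \<le> n" "H a r \<le> n"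
    using le by linarith+
  with ar show "(a, r) \<in> {1..n} \<times> {1..d}" "H a r \<le> n"
    by auto
qed

text \<open>Restriction to the grid is inverted by extension by zero. The condition on the weight
  stays on the right because a grid function may well have weight above \<open>n\<close>.\<close>

lemma bij_betw_histograms_grid_functions:
  "bij_betw (\<lambda>H. restrict (\<lambda>(a, r). H a r) ({1..n} \<times> {1..d}))
     (histograms d n) {g \<in> grid_functions d n. grid_weight d n g \<le> n}"
proof (rule bij_betw_byWitness
    [where f' = "\<lambda>g a r. if (a, r) \<in> {1..n} \<times> {1..d} then g (a, r) else 0"])
  let ?I = "{1..n} \<times> {1..d}"
  let ?to = "\<lambda>H. restrict (\<lambda>(a, r). H a r) ?I"
  let ?of = "\<lambda>g a r. if (a, r) \<in> ?I then g (a, r) else (0::nat)"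
  show "\<forall>H\<in>histograms d n. ?of (?to H) = H"
    using histograms_support(1) by (fastforce simp: fun_eq_iff)
  show "\<forall>g\<in>{g \<in> grid_functions d n. grid_weight d n g \<le> n}. ?to (?of g) = g"
    by (auto simp: fun_eq_iff grid_functions_def PiE_def extensional_def)
  show "?to ` histograms d n \<subseteq> {g \<in> grid_functions d n. grid_weight d n g \<le> n}"
  proof safe
    fix H assume H: "H \<in> histograms d n"
    show "?to H \<in> grid_functions d n"
    proof -
      have "H a r \<le> n" for a r
        using histograms_support(2)[OF H, of a r] by (cases "H a r = 0") auto
      then show ?thesis
        by (auto simp: grid_functions_def)
    qed
    have "grid_weight d n (?to H) = grid_weight d n (\<lambda>(a, r). H a r)"
      unfolding grid_weight_def by (intro sum.cong) auto
    also have "\<dots> = histogram_size d H"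
      using histograms_support(1)[OF H] by (intro histogram_size_eq_grid_weight[symmetric])
    finally show "grid_weight d n (?to H) \<le> n"
      using H by (simp add: histograms_def)
  qed
  show "?of ` {g \<in> grid_functions d n. grid_weight d n g \<le> n} \<subseteq> histograms d n"
  proof safe
    fix g assume g: "grid_weight d n g \<le> n"
    have supp: "?of g a r \<noteq> 0 \<Longrightarrow> (a, r) \<in> ?I" for a r
      by (auto split: if_splits)
    have "finite {(a, r). ?of g a r \<noteq> 0}"
      by (rule finite_subset[of _ ?I]) (use supp in auto)
    then have "normalized_histogram d (?of g)"
      using supp unfolding normalized_histogram_def by auto
    moreover have "histogram_size d (?of g) = grid_weight d n (\<lambda>(a, r). ?of g a r)"
      using supp by (rule histogram_size_eq_grid_weight)
    moreover have "\<dots> = grid_weight d n g"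
      unfolding grid_weight_def by (intro sum.cong) auto
    ultimately show "?of g \<in> histograms d n"
      using g by (simp add: histograms_def)
  qed
qed

lemma card_histograms:
  "card (histograms d n) = card {g \<in> grid_functions d n. grid_weight d n g \<le> n}"
  using bij_betw_histograms_grid_functions by (rule bij_betw_same_card)

text \<open>Distributivity: expanding the product over all grid points picks one exponent per point.
  Stated over a semiring, it serves both for \<open>fps_X\<close> and for a real number.\<close>

lemma sum_power_grid_weight:
  fixes x :: "'a::comm_semiring_1"
  shows "(\<Sum>g\<in>grid_functions d n. x ^ grid_weight d n g) =
    (\<Prod>a=1..n. (\<Sum>h\<le>n. x ^ (a * h)) ^ d)"
proof -
  let ?I = "{1..n} \<times> {1..d}"
  have "(\<Sum>g\<in>grid_functions d n. x ^ grid_weight d n g) =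
      (\<Sum>g\<in>?I \<rightarrow>\<^sub>E {..n}. \<Prod>p\<in>?I. x ^ (fst p * g p))"
    by (simp add: grid_functions_def grid_weight_def power_sum)
  also have "\<dots> = (\<Prod>p\<in>?I. \<Sum>h\<le>n. x ^ (fst p * h))"
    by (subst prod_sum_PiE) auto
  also have "\<dots> = (\<Prod>a=1..n. \<Prod>r=1..d. \<Sum>h\<le>n. x ^ (a * h))"
    unfolding prod.cartesian_product by (simp add: split_beta)
  finally show ?thesis
    by simp
qed

subsection \<open>The generating function\<close>

text \<open>Truncation modulo \<open>fps_X ^ Suc n\<close> is compatible with products, which is
  what allows replacing each factor by a polynomial.\<close>

lemma fps_prod_nth_cong:
  fixes f g :: "'b \<Rightarrow> 'a::comm_semiring_1 fps"
  assumes "\<And>i k. i \<in> A \<Longrightarrow> k \<le> n \<Longrightarrow> fps_nth (f i) k = fps_nth (g i) k" and "m \<le> n"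
  shows "fps_nth (prod f A) m = fps_nth (prod g A) m"
  using assms
proof (induction A arbitrary: m rule: infinite_finite_induct)
  case (insert i A)
  have "fps_nth (f i * prod f A) m = fps_nth (g i * prod g A) m"
    unfolding fps_mult_nth using insert.prems
    by (intro sum.cong refl arg_cong2[of _ _ _ _ "(*)"] insert.IH) auto
  with insert.hyps show ?case
    by simp
qed auto

lemma fps_power_nth_cong:
  fixes f g :: "'a::comm_semiring_1 fps"
  assumes "\<And>k. k \<le> n \<Longrightarrow> fps_nth f k = fps_nth g k" and "m \<le> n"
  shows "fps_nth (f ^ d) m = fps_nth (g ^ d) m"
  using fps_prod_nth_cong[of "{..<d}" n "\<lambda>_. f" "\<lambda>_. g"] assms by simp

text \<open>The truncated geometric series differs from the full one by a multiple of
  \<open>fps_X ^ (a * Suc n)\<close>, whose exponent exceeds \<open>m\<close>.\<close>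

lemma fps_inverse_one_minus_X_power_nth:
  fixes n :: nat
  assumes "a \<ge> 1" "m \<le> n"
  shows "fps_nth (inverse (1 - fps_X ^ a :: 'a::field fps)) m =
    fps_nth (\<Sum>h\<le>n. fps_X ^ (a * h)) m"
proof -
  let ?u = "1 - fps_X ^ a :: 'a fps" and ?S = "\<Sum>h\<le>n. fps_X ^ (a * h) :: 'a fps"
  have u: "?u * inverse ?u = 1"
    using assms(1) by (simp add: inverse_mult_eq_1')
  have uS: "?u * ?S = 1 - fps_X ^ (a * Suc n)"
    using one_diff_power_eq[of "fps_X ^ a :: 'a fps" "Suc n"]
    by (simp add: power_mult lessThan_Suc_atMost del: power_Suc mult_Suc_right)
  have "?S = ?S * (?u * inverse ?u)"
    using u by simp
  also have "\<dots> = (?u * ?S) * inverse ?u"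
    by (simp only: mult_ac)
  also have "\<dots> = inverse ?u - fps_X ^ (a * Suc n) * inverse ?u"
    unfolding uS by (simp only: left_diff_distrib mult_1_left)
  finally have "?S = inverse ?u - fps_X ^ (a * Suc n) * inverse ?u" .
  moreover have "m < a * Suc n"
    using assms(2) mult_le_mono1[OF assms(1), of "Suc n"] by simp
  ultimately show ?thesis
    by (simp add: fps_X_power_mult_nth del: mult_Suc_right)
qed

text \<open>Factor \<open>i\<close> is 1 up to degree \<open>i\<close>, so the coefficient of degree
  \<open>j\<close> no longer changes once the first \<open>j\<close> factors are multiplied.\<close>

lemma prodinf_fps_nth:
  fixes f :: "nat \<Rightarrow> 'a::idom fps"
  assumes "\<And>i. fps_nth (f i) 0 = 1"
    and "\<And>i k. 0 < k \<Longrightarrow> k \<le> i \<Longrightarrow> fps_nth (f i) k = 0" and "m \<le> n"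
  shows "fps_nth (prodinf f) m = fps_nth (\<Prod>i<n. f i) m"
proof -
  have stable: "fps_nth (\<Prod>i<k. f i) j = fps_nth (\<Prod>i<l. f i) j" if "j \<le> l" "l \<le> k" for j k l
  proof -
    have "fps_nth (\<Prod>i<k. f i) j = fps_nth (\<Prod>i<k. if i < l then f i else 1) j"
      using assms that by (intro fps_prod_nth_cong[where n = j]) auto
    also have "(\<Prod>i<k. if i < l then f i else 1) = (\<Prod>i<l. f i)"
      using that by (intro prod.mono_neutral_cong_right) auto
    finally show ?thesis .
  qed
  \<comment> \<open>The limit is read off diagonally: coefficient \<open>j\<close> is already final
    in the product of \<open>j\<close> factors.\<close>
  define L where "L = Abs_fps (\<lambda>j. fps_nth (\<Prod>i<j. f i) j)"
  have "(\<lambda>k. \<Prod>i\<le>k. f i) \<longlonglongrightarrow> L"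
    unfolding tendsto_fps_iff
  proof
    fix j
    show "\<forall>\<^sub>F k in sequentially. fps_nth (\<Prod>i\<le>k. f i) j = fps_nth L j"
      using eventually_ge_at_top[of j]
    proof eventually_elim
      case (elim k)
      then show ?case
        using stable[of j j "Suc k"] by (simp add: L_def lessThan_Suc_atMost)
    qed
  qed
  \<comment> \<open>Convergence of an infinite product demands a nonzero limit; here the constant
    coefficient is that of the empty product.\<close>
  moreover have "L \<noteq> 0"
    by (auto simp: L_def fps_eq_iff intro!: exI[of _ 0])
  ultimately have "f has_prod L"
    by (simp add: has_prod_def raw_has_prod_def)
  then have "prodinf f = L"
    using has_prod_unique by metis
  then show ?thesis
    using stable[of m m n] \<open>m \<le> n\<close> by (simp add: L_def)
qed

text \<open>Up to degree \<open>n\<close>, only the factors with \<open>a \<le> n\<close> matter,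
  and in each only the terms with \<open>h \<le> n\<close>; the resulting finite product is then
  expanded.\<close>

lemma histogram_gf_nth:
  assumes "m \<le> n"
  shows "fps_nth (histogram_gf d) m =
    fps_nth (\<Sum>g\<in>grid_functions d n. fps_X ^ grid_weight d n g) m"
proof -
  let ?f = "\<lambda>i. inverse (1 - fps_X ^ Suc i :: real fps) ^ d"
  have gf: "histogram_gf d = prodinf ?f"
    unfolding histogram_gf_def
    \<comment> \<open>\<open>powi\<close> unfolds to a power of the inverse only for a negative
      exponent, hence the case split.\<close>
    by (cases "d = 0") (simp_all add: power_int_def fps_inverse_power)
  have f: "fps_nth (?f i) k = fps_nth 1 k" if "k \<le> i" for i k
  proof -
    have "fps_nth (inverse (1 - fps_X ^ Suc i :: real fps)) j = fps_nth 1 j" if "j \<le> i" for j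
    proof -
      have "j = Suc i * h \<longleftrightarrow> j = 0 \<and> h = 0" for h
        using that by (cases h) auto
      then show ?thesis
        using that fps_inverse_one_minus_X_power_nth[of "Suc i" j i]
        by (cases "j = 0") (simp_all add: fps_sum_nth del: power_Suc mult_Suc)
    qed
    then show ?thesis
      using fps_power_nth_cong[of i "inverse (1 - fps_X ^ Suc i)" 1 k d] that
      unfolding power_one by blast
  qed
  have "fps_nth (histogram_gf d) m = fps_nth (\<Prod>i<n. ?f i) m"
    unfolding gf using assms by (intro prodinf_fps_nth) (auto simp: f simp del: power_Suc)
  also have "\<dots> = fps_nth (\<Prod>i<n. (\<Sum>h\<le>n. fps_X ^ (Suc i * h)) ^ d) m"
    using assms
    by (intro fps_prod_nth_cong[where n = n] fps_power_nth_cong[where n = n]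
        fps_inverse_one_minus_X_power_nth) auto
  also have "(\<Prod>i<n. (\<Sum>h\<le>n. fps_X ^ (Suc i * h) :: real fps) ^ d) =
      (\<Prod>a=1..n. (\<Sum>h\<le>n. fps_X ^ (a * h)) ^ d)"
    by (rule prod.reindex_bij_witness[of _ "\<lambda>a. a - 1" Suc]) auto
  finally show ?thesis
    by (simp add: sum_power_grid_weight)
qed

lemma sum_histogram_gf_nth:
  "(\<Sum>m=0..n. fps_nth (histogram_gf d) m) = real (card (histograms d n))"
proof -
  let ?G = "grid_functions d n" and ?w = "grid_weight d n"
  have "(\<Sum>m=0..n. fps_nth (histogram_gf d) m) = (\<Sum>m=0..n. \<Sum>g\<in>?G. if m = ?w g then 1 else 0)"
    by (intro sum.cong refl) (simp add: histogram_gf_nth[of _ n] fps_sum_nth)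
  \<comment> \<open>After swapping the sums, each grid function is counted once, at the degree equal
    to its weight, provided that degree is at most \<open>n\<close>.\<close>
  also have "\<dots> = (\<Sum>g\<in>?G. if ?w g \<le> n then 1 else 0)"
    by (subst sum.swap) simp
  also have "\<dots> = real (card {g \<in> ?G. ?w g \<le> n})"
    by (simp add: finite_grid_functions sum.If_cases Int_def)
  finally show ?thesis
    by (simp add: card_histograms)
qed

subsection \<open>The bound\<close>

text \<open>With \<open>q = exp (- s)\<close>, the full geometric series is
  \<open>q / (1 - q) = 1 / (exp s - 1)\<close>, and \<open>exp s - 1 \<ge> s\<close>.\<close>

lemma sum_exp_multiples_le:
  fixes s :: real
  assumes "s > 0"
  shows "(\<Sum>a=1..n. exp (- s) ^ a) \<le> 1 / s"
proof -
  define q where "q = exp (- s)"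
  have q: "0 < q" "q < 1"
    using assms by (auto simp: q_def)
  have "(1 - q) * (\<Sum>a=1..n. q ^ a) = q * (1 - q ^ n)"
  proof (induction n)
    case (Suc n)
    then show ?case
      by (simp add: distrib_left) (simp add: algebra_simps)
  qed simp
  also have "\<dots> \<le> q"
    using q by (simp add: mult_le_cancel_left1)
  finally have *: "(1 - q) * (\<Sum>a=1..n. q ^ a) \<le> q" .
  have "q * (1 + s) \<le> q * exp s"
    using q exp_ge_add_one_self[of s] by (intro mult_left_mono) auto
  then have "s * q \<le> 1 - q"
    by (simp add: q_def algebra_simps flip: exp_add)
  then have "s * q * (\<Sum>a=1..n. q ^ a) \<le> (1 - q) * (\<Sum>a=1..n. q ^ a)"
    using q by (intro mult_right_mono sum_nonneg) auto
  with * have "q * (s * (\<Sum>a=1..n. q ^ a)) \<le> q * 1"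
    by (simp add: algebra_simps)
  then have "s * (\<Sum>a=1..n. q ^ a) \<le> 1"
    using q by (simp only: mult_le_cancel_left_pos)
  then show ?thesis
    using assms by (simp add: q_def field_simps)
qed

text \<open>In the double series of \<open>x ^ (a * k) / k\<close>, summing over \<open>a\<close>
  first gives at most \<open>1 / (k * t)\<close>, so the term for \<open>k\<close> is at most
  \<open>1 / (k\<^sup>2 * t)\<close>.\<close>

lemma sum_ln_euler_factors_le:
  fixes t :: real
  assumes "t > 0"
  shows "(\<Sum>a=1..n. - ln (1 - exp (- t) ^ a)) \<le> pi\<^sup>2 / (6 * t)"
proof -
  define x where "x = exp (- t)"
  have x: "0 < x" "x < 1"
    using assms by (auto simp: x_def)
  \<comment> \<open>The logarithm series may start at \<open>k = 0\<close>, as division by zero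
    yields 0 there.\<close>
  have "(\<lambda>k. (x ^ a) ^ k / real k) sums - ln (1 - x ^ a)" if "a \<in> {1..n}" for a
    using ln_series'[of "- (x ^ a)"] x that sums_minus[of "\<lambda>k. - ((x ^ a) ^ k / real k)"]
    by (simp add: power_less_one_iff)
  then have lhs: "(\<lambda>k. \<Sum>a=1..n. (x ^ a) ^ k / real k) sums (\<Sum>a=1..n. - ln (1 - x ^ a))"
    by (rule sums_sum)
  have "(\<lambda>k. 1 / (real (Suc k))\<^sup>2) sums (pi\<^sup>2 / 6)"
    using inverse_squares_sums by (simp add: add.commute)
  then have "(\<lambda>k. 1 / (real k)\<^sup>2) sums (pi\<^sup>2 / 6)"
    \<comment> \<open>The index shift adds only the term \<open>1 / 0 = 0\<close>.\<close>
    by (subst (asm) sums_Suc_iff) simp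
  then have rhs: "(\<lambda>k. 1 / (real k)\<^sup>2 * (1 / t)) sums (pi\<^sup>2 / 6 * (1 / t))"
    by (rule sums_mult2)
  have le: "(\<Sum>a=1..n. (x ^ a) ^ k / real k) \<le> 1 / (real k)\<^sup>2 * (1 / t)" for k
  proof (cases "k = 0")
    case False
    have "(\<Sum>a=1..n. (x ^ a) ^ k / real k) = (\<Sum>a=1..n. exp (- (real k * t)) ^ a) / real k"
      by (simp add: x_def sum_divide_distrib mult_ac flip: exp_of_nat_mult power_mult)
    also have "\<dots> \<le> 1 / (real k * t) / real k"
      using assms False by (intro divide_right_mono sum_exp_multiples_le) auto
    finally show ?thesis
      by (simp add: power2_eq_square mult_ac)
  qed auto
  have "(\<Sum>a=1..n. - ln (1 - x ^ a)) \<le> pi\<^sup>2 / 6 * (1 / t)"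
    using le lhs rhs by (rule sums_le)
  then show ?thesis
    by (simp add: x_def)
qed

text \<open>Rankin's trick: each counted function gets weight
  \<open>x ^ n \<le> x ^ grid_weight d n g\<close>, and then the restriction on the weight is
  dropped, leaving an Euler product.\<close>

lemma card_histograms_le_exp:
  fixes t :: real
  assumes "t > 0"
  shows "real (card (histograms d n)) \<le> exp (real n * t + real d * (pi\<^sup>2 / (6 * t)))"
proof -
  define x where "x = exp (- t)"
  have x: "0 < x" "x < 1"
    using assms by (auto simp: x_def)
  let ?G = "grid_functions d n" and ?w = "grid_weight d n"
  have factor: "(\<Sum>h\<le>n. x ^ (a * h)) \<le> exp (- ln (1 - x ^ a))" if "a \<in> {1..n}" for a
  proof -
    have xa: "0 < x ^ a" "x ^ a < 1"
      using x that by (auto simp: power_less_one_iff)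
    have "(\<Sum>h\<le>n. x ^ (a * h)) = (\<Sum>h<Suc n. (x ^ a) ^ h)"
      by (simp add: lessThan_Suc_atMost power_mult)
    also have "\<dots> \<le> 1 / (1 - x ^ a)"
      unfolding sum_gp_strict using xa by (simp add: divide_right_mono)
    finally show ?thesis
      using xa by (simp add: exp_minus field_simps)
  qed
  have "x ^ n * real (card (histograms d n)) = (\<Sum>g | g \<in> ?G \<and> ?w g \<le> n. x ^ n)"
    by (simp add: card_histograms)
  also have "\<dots> \<le> (\<Sum>g | g \<in> ?G \<and> ?w g \<le> n. x ^ ?w g)"
    using x by (intro sum_mono power_decreasing) auto
  also have "\<dots> \<le> (\<Sum>g\<in>?G. x ^ ?w g)"
    using x by (intro sum_mono2 finite_grid_functions) auto
  also have "\<dots> = (\<Prod>a=1..n. (\<Sum>h\<le>n. x ^ (a * h)) ^ d)"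
    by (rule sum_power_grid_weight)
  also have "\<dots> \<le> (\<Prod>a=1..n. exp (- ln (1 - x ^ a)) ^ d)"
    using x factor by (intro prod_mono conjI power_mono zero_le_power sum_nonneg) auto
  also have "\<dots> = exp (real d * (\<Sum>a=1..n. - ln (1 - x ^ a)))"
    by (simp only: prod_power_distrib[symmetric] exp_sum[symmetric] finite_atLeastAtMost exp_of_nat_mult)
  also have "\<dots> \<le> exp (real d * (pi\<^sup>2 / (6 * t)))"
    using sum_ln_euler_factors_le[OF assms, of n] unfolding x_def by (intro iffD2[OF exp_le_cancel_iff] mult_left_mono) auto
  finally have "exp (real n * t) * (x ^ n * real (card (histograms d n))) \<le>
      exp (real n * t) * exp (real d * (pi\<^sup>2 / (6 * t)))"
    by (rule mult_left_mono) simp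
  \<comment> \<open>The factor \<open>x ^ n\<close> is cancelled by its inverse.\<close>
  moreover have "exp (real n * t) * x ^ n = 1"
    by (simp add: x_def flip: exp_of_nat_mult exp_add)
  ultimately show ?thesis
    by (simp add: exp_add flip: mult.assoc)
qed

theorem proposition5p1:
  fixes d n :: nat
  assumes "d \<ge> 1" and "n \<ge> 1"
  shows "real (card (histograms d n)) = (\<Sum>m=0..n. fps_nth (histogram_gf d) m) \<and>
    (\<Sum>m=0..n. fps_nth (histogram_gf d) m) \<le> exp (pi * sqrt (2 * real d * real n / 3))"
proof -
  define s where "s = sqrt (2 * real d * real n / 3)"
  \<comment> \<open>This \<open>t\<close> equals \<open>pi * sqrt (d / (6 * n))\<close>, where the
    two terms of the exponent balance: each becomes \<open>pi * s / 2\<close>, and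
    \<open>pi * s\<close> is the exponent sought.\<close>
  define t where "t = pi * s / (2 * real n)"
  have s: "s > 0" and s2: "s * s = 2 * real d * real n / 3"
    using assms by (auto simp: s_def)
  have t: "t > 0"
    using s assms by (simp add: t_def)
  have "real d = 3 * (s * s) / (2 * real n)"
    using assms by (simp add: s2)
  then have "real d * (pi\<^sup>2 / (6 * t)) = pi * s / 2"
    using s assms by (simp add: t_def power2_eq_square)
  moreover have "real n * t = pi * s / 2"
    using assms by (simp add: t_def)
  ultimately have "real n * t + real d * (pi\<^sup>2 / (6 * t)) = pi * s"
    by linarith
  then have "real (card (histograms d n)) \<le> exp (pi * s)"
    using card_histograms_le_exp[OF t, of d n] by (simp only:)
  then show ?thesis
    by (simp add: sum_histogram_gf_nth s_def)
qed

end
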